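(* Let $R=\mathbb F_{q_1}\times\cdots\times\mathbb F_{q_t}$ be a product of $t\ge 3$ finite fields. Then $\operatorname{girth}(\mathcal D(R))=3$.
   Context: $Z(R)$ is the set of zero-divisors of $R$ and $Z(R)^*=Z(R)\setminus\{0\}$. $\Gamma(R)$ is the simple graph with vertex set $Z(R)^*$, with distinct $x,y$ adjacent iff $xy=0$. $W\Gamma(R)$ is the simple graph with vertex set $Z(R)^*$, with distinct $x,y$ adjacent iff there exist nonzero $r\in\operatorname{Ann}(x)$ and nonzero $s\in\operatorname{Ann}(y)$ with $rs=0$. The weak zero-divisor difference graph $\mathcal D(R)$ is the graph on $Z(R)^*$ with edge set $E(W\Gamma(R))\setminus E(\Gamma(R))$, with resulting isolated vertices deleted. The girth is the length of a shortest cycle. *)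

theory Defs
  imports
    "HOL-Algebra.Algebra"
    "HOL-Library.Extended_Nat"
    "Graph_Theory.Pair_Digraph"
begin

text \<open>
  A simple graph is a \<^typ>\<open>'a pair_pre_digraph\<close> whose arc relation is symmetric and
  irreflexive: an edge between \<open>x\<close> and \<open>y\<close> is the pair of opposite arcs \<open>(x, y)\<close> and \<open>(y, x)\<close>.
  The lemmas at the end show that the graphs below are of this kind over a commutative ring.
\<close>

subsection \<open>Girth of a simple graph\<close>

text \<open>
  The directed cycles of the library include the back-and-forth walk \<open>(x, y), (y, x)\<close> along a
  single edge, which is not a cycle of the simple graph; a directed cycle of length at least 3
  visits pairwise distinct vertices and so is a cycle of the simple graph. The girth of a graph
  without cycles is \<^term>\<open>\<infinity> :: enat\<close>, the infimum of the empty set.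
\<close>

definition graph_cycle :: "'a pair_pre_digraph \<Rightarrow> ('a \<times> 'a) list \<Rightarrow> bool" where
  "graph_cycle G p \<longleftrightarrow> pre_digraph.cycle (with_proj G) p \<and> 3 \<le> length p"

definition girth :: "'a pair_pre_digraph \<Rightarrow> enat" where
  "girth G = (INF p \<in> {p. graph_cycle G p}. enat (length p))"

definition delete_isolated :: "'a pair_pre_digraph \<Rightarrow> 'a pair_pre_digraph" where
  "delete_isolated G =
     \<lparr> pverts = {x \<in> pverts G. \<exists>y. (x, y) \<in> parcs G \<or> (y, x) \<in> parcs G}, parcs = parcs G \<rparr>"

subsection \<open>Zero-divisor graphs of a commutative ring\<close>

definition zero_divisors :: "('a, 'm) ring_scheme \<Rightarrow> 'a set" where
  "zero_divisors R =
     {x \<in> carrier R. \<exists>y \<in> carrier R. y \<noteq> \<zero>\<^bsub>R\<^esub> \<and> x \<otimes>\<^bsub>R\<^esub> y = \<zero>\<^bsub>R\<^esub>}"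

definition annihilator :: "('a, 'm) ring_scheme \<Rightarrow> 'a \<Rightarrow> 'a set" where
  "annihilator R x = {r \<in> carrier R. r \<otimes>\<^bsub>R\<^esub> x = \<zero>\<^bsub>R\<^esub>}"

definition zero_divisor_graph :: "('a, 'm) ring_scheme \<Rightarrow> 'a pair_pre_digraph" where
  "zero_divisor_graph R =
     (let V = zero_divisors R - {\<zero>\<^bsub>R\<^esub>} in
      \<lparr> pverts = V,
        parcs = {(x, y). x \<in> V \<and> y \<in> V \<and> x \<noteq> y \<and> x \<otimes>\<^bsub>R\<^esub> y = \<zero>\<^bsub>R\<^esub>} \<rparr>)"

definition weak_zero_divisor_graph :: "('a, 'm) ring_scheme \<Rightarrow> 'a pair_pre_digraph" where
  "weak_zero_divisor_graph R =
     (let V = zero_divisors R - {\<zero>\<^bsub>R\<^esub>} in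
      \<lparr> pverts = V,
        parcs = {(x, y). x \<in> V \<and> y \<in> V \<and> x \<noteq> y \<and>
          (\<exists>r \<in> annihilator R x. \<exists>s \<in> annihilator R y.
             r \<noteq> \<zero>\<^bsub>R\<^esub> \<and> s \<noteq> \<zero>\<^bsub>R\<^esub> \<and> r \<otimes>\<^bsub>R\<^esub> s = \<zero>\<^bsub>R\<^esub>)} \<rparr>)"

definition weak_zero_divisor_difference_graph ::
    "('a, 'm) ring_scheme \<Rightarrow> 'a pair_pre_digraph" where
  "weak_zero_divisor_difference_graph R =
     delete_isolated
       \<lparr> pverts = zero_divisors R - {\<zero>\<^bsub>R\<^esub>},
         parcs = parcs (weak_zero_divisor_graph R) - parcs (zero_divisor_graph R) \<rparr>"

lemma annihilator_in_carrier: "r \<in> annihilator R x \<Longrightarrow> r \<in> carrier R"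
  by (simp add: annihilator_def)

lemma (in cring) sym_parcs_zero_divisor_graph: "sym (parcs (zero_divisor_graph R))"
  by (auto simp: sym_def zero_divisor_graph_def zero_divisors_def Let_def m_comm)

lemma (in cring) sym_parcs_weak_zero_divisor_graph: "sym (parcs (weak_zero_divisor_graph R))"
  unfolding sym_def weak_zero_divisor_graph_def Let_def
  by (auto; metis annihilator_in_carrier m_comm)

lemma (in cring) sym_parcs_weak_zero_divisor_difference_graph:
  "sym (parcs (weak_zero_divisor_difference_graph R))"
  using sym_parcs_zero_divisor_graph sym_parcs_weak_zero_divisor_graph
  by (auto simp: sym_def weak_zero_divisor_difference_graph_def delete_isolated_def)

lemma (in cring) simple_graph_zero_divisor_graph:
  "pair_sym_digraph (zero_divisor_graph R) \<and> pair_loopfree_digraph (zero_divisor_graph R)"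
  using sym_parcs_zero_divisor_graph
  by (auto simp: pair_sym_digraph_def pair_sym_digraph_axioms_def pair_loopfree_digraph_def
      pair_loopfree_digraph_axioms_def pair_wf_digraph_def symmetric_def
      zero_divisor_graph_def Let_def)

lemma (in cring) simple_graph_weak_zero_divisor_graph:
  "pair_sym_digraph (weak_zero_divisor_graph R) \<and>
   pair_loopfree_digraph (weak_zero_divisor_graph R)"
  using sym_parcs_weak_zero_divisor_graph
  by (auto simp: pair_sym_digraph_def pair_sym_digraph_axioms_def pair_loopfree_digraph_def
      pair_loopfree_digraph_axioms_def pair_wf_digraph_def symmetric_def
      weak_zero_divisor_graph_def Let_def)

lemma (in cring) simple_graph_weak_zero_divisor_difference_graph:
  "pair_sym_digraph (weak_zero_divisor_difference_graph R) \<and>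
   pair_loopfree_digraph (weak_zero_divisor_difference_graph R)"
proof -
  have "x \<in> zero_divisors R - {\<zero>} \<and> y \<in> zero_divisors R - {\<zero>} \<and> x \<noteq> y"
    if "(x, y) \<in> parcs (weak_zero_divisor_graph R)" for x y
    using that by (auto simp: weak_zero_divisor_graph_def Let_def)
  then show ?thesis
    using sym_parcs_weak_zero_divisor_difference_graph
    by (fastforce simp: pair_sym_digraph_def pair_sym_digraph_axioms_def pair_loopfree_digraph_def
        pair_loopfree_digraph_axioms_def pair_wf_digraph_def symmetric_def
        weak_zero_divisor_difference_graph_def delete_isolated_def)
qed

end

theory Submission
  imports Defs
begin

text \<open>
  If \<open>e\<^sub>1, e\<^sub>2, e\<^sub>3\<close> are nonzero pairwise orthogonal idempotents of a ring, then
  \<open>e\<^sub>1\<close>, \<open>e\<^sub>1 + e\<^sub>2\<close>, \<open>e\<^sub>1 + e\<^sub>3\<close> form a triangle: any two of them have the nonzero product \<open>e\<^sub>1\<close>,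
  while their annihilators contain \<open>e\<^sub>2\<close> or \<open>e\<^sub>3\<close> so that orthogonal nonzero elements can be chosen.
  A product of at least three fields contains three such idempotents, namely unit vectors.
\<close>

text \<open>This covers acyclic graphs too: the infimum over the empty set is
  \<open>\<infinity>\<close>.\<close>

lemma girth_ge_3: "3 \<le> girth G"
  by (auto simp: girth_def graph_cycle_def le_INF_iff numeral_eq_enat)

lemma girth_eq_3_if_triangle:
  assumes "x \<in> pverts G" "(x, y) \<in> parcs G" "(y, z) \<in> parcs G" "(z, x) \<in> parcs G"
    and "x \<noteq> y" "y \<noteq> z" "z \<noteq> x"
  shows "girth G = 3"
proof (rule antisym[OF _ girth_ge_3])
  let ?p = "[(x, y), (y, z), (z, x)]"
  have "pre_digraph.awalk (with_proj G) x ?p x"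
    using assms by (simp add: pre_digraph.awalk_def pre_digraph.cas.simps)
  \<comment> \<open>The vertices of the walk are \<open>[x, y, z, x]\<close>; \<open>tl\<close>
    drops the repeated start.\<close>
  moreover have "distinct (tl (pre_digraph.awalk_verts (with_proj G) x ?p))"
    using assms by (simp add: pre_digraph.awalk_verts.simps)
  ultimately have "graph_cycle G ?p"
    unfolding graph_cycle_def pre_digraph.cycle_def by auto
  then have "girth G \<le> enat (length ?p)"
    unfolding girth_def by (intro INF_lower) simp
  then show "girth G \<le> 3"
    by (simp add: numeral_eq_enat numeral_3_eq_3)
qed

text \<open>Deleting isolated vertices keeps all arcs. For distinct nonzero zero-divisors, being no
  arc of the zero-divisor graph just means a nonzero product.\<close>

lemma arc_weak_zero_divisor_difference_graph_iff:
  "(x, y) \<in> parcs (weak_zero_divisor_difference_graph R) \<longleftrightarrow>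
     x \<in> zero_divisors R - {\<zero>\<^bsub>R\<^esub>} \<and> y \<in> zero_divisors R - {\<zero>\<^bsub>R\<^esub>} \<and>
     x \<noteq> y \<and> x \<otimes>\<^bsub>R\<^esub> y \<noteq> \<zero>\<^bsub>R\<^esub> \<and>
     (\<exists>r \<in> annihilator R x. \<exists>s \<in> annihilator R y.
        r \<noteq> \<zero>\<^bsub>R\<^esub> \<and> s \<noteq> \<zero>\<^bsub>R\<^esub> \<and> r \<otimes>\<^bsub>R\<^esub> s = \<zero>\<^bsub>R\<^esub>)"
  by (auto simp: weak_zero_divisor_difference_graph_def delete_isolated_def
      weak_zero_divisor_graph_def zero_divisor_graph_def Let_def)

lemma tail_in_pverts_weak_zero_divisor_difference_graph:
  assumes "(x, y) \<in> parcs (weak_zero_divisor_difference_graph R)"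
  shows "x \<in> pverts (weak_zero_divisor_difference_graph R)"
  using assms arc_weak_zero_divisor_difference_graph_iff[of x y R]
  by (auto simp: weak_zero_divisor_difference_graph_def delete_isolated_def)

text \<open>Orthogonality is stated in both orders because \<open>ring\<close> does not include
  commutativity.\<close>

lemma (in ring) girth_eq_3_if_orthogonal_idempotents:
  assumes carr [simp]: "a \<in> carrier R" "b \<in> carrier R" "c \<in> carrier R"
    and nz: "a \<noteq> \<zero>" "b \<noteq> \<zero>" "c \<noteq> \<zero>"
    and idem [simp]: "a \<otimes> a = a" "b \<otimes> b = b" "c \<otimes> c = c"
    and orth [simp]: "a \<otimes> b = \<zero>" "b \<otimes> a = \<zero>" "a \<otimes> c = \<zero>" "c \<otimes> a = \<zero>" "b \<otimes> c = \<zero>" "c \<otimes> b = \<zero>"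
  shows "girth (weak_zero_divisor_difference_graph R) = 3"
proof -
  let ?G = "weak_zero_divisor_difference_graph R"
  let ?y = "a \<oplus> b" and ?z = "a \<oplus> c"
  have prods: "a \<otimes> ?y = a" "?y \<otimes> ?z = a" "?z \<otimes> a = a"
    by (simp_all add: l_distr r_distr)
  have nonzero: "?y \<noteq> \<zero>" "?z \<noteq> \<zero>"
    using prods nz by force+
  \<comment> \<open>Left multiplication by \<open>b\<close> sends \<open>a\<close>,
    \<open>?y\<close>, \<open>?z\<close> to \<zero>, \<open>b\<close>, \<zero>; that by
    \<open>c\<close> sends \<open>?z\<close>, \<open>a\<close> to \<open>c\<close>, \<zero>.\<close>
  have "b \<otimes> a \<noteq> b \<otimes> ?y" "b \<otimes> ?y \<noteq> b \<otimes> ?z" "c \<otimes> ?z \<noteq> c \<otimes> a"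
    using nz by (simp_all add: r_distr)
  then have distinct: "a \<noteq> ?y" "?y \<noteq> ?z" "?z \<noteq> a"
    by auto
  have ann: "b \<in> annihilator R a" "c \<in> annihilator R a" "c \<in> annihilator R ?y"
      "b \<in> annihilator R ?z"
    by (simp_all add: annihilator_def r_distr)
  \<comment> \<open>\<open>zero_divisors\<close> multiplies on the right, \<open>annihilator\<close>
    on the left.\<close>
  have "a \<otimes> b = \<zero>" "?y \<otimes> c = \<zero>" "?z \<otimes> b = \<zero>"
    by (simp_all add: l_distr)
  then have zdiv: "a \<in> zero_divisors R" "?y \<in> zero_divisors R" "?z \<in> zero_divisors R"
    using nz by (auto simp: zero_divisors_def)
  \<comment> \<open>The witnesses \<open>(r, s)\<close> are \<open>(b, c)\<close>,
    \<open>(c, b)\<close> and \<open>(b, c)\<close>, in this order.\<close>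
  have xy: "(a, ?y) \<in> parcs ?G" and "(?y, ?z) \<in> parcs ?G" "(?z, a) \<in> parcs ?G"
    using zdiv distinct prods nonzero nz ann orth
    unfolding arc_weak_zero_divisor_difference_graph_iff by force+
  then show ?thesis
    using distinct
    by (intro girth_eq_3_if_triangle[OF tail_in_pverts_weak_zero_divisor_difference_graph[OF xy]])
qed

text \<open>Consing is a ring homomorphism from the binary product of \<open>R\<close> and
  \<open>RDirProd_list Rs\<close>, whose multiplication is componentwise.\<close>

lemma RDirProd_list_mult_Cons:
  assumes "a \<in> carrier R" "b \<in> carrier R"
    and "as \<in> carrier (RDirProd_list Rs)" "bs \<in> carrier (RDirProd_list Rs)"
  shows "(a # as) \<otimes>\<^bsub>RDirProd_list (R # Rs)\<^esub> (b # bs) =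
    (a \<otimes>\<^bsub>R\<^esub> b) # (as \<otimes>\<^bsub>RDirProd_list Rs\<^esub> bs)"
  using ring_hom_mult[OF RDirProd_list_hom1[of R Rs], of "(a, as)" "(b, bs)"] assms
  by (simp add: RDirProd_carrier RDirProd_def DirProd_def monoid.defs)

lemma RDirProd_list_Cons_in_carrier:
  assumes "a \<in> carrier R" "as \<in> carrier (RDirProd_list Rs)"
  shows "a # as \<in> carrier (RDirProd_list (R # Rs))"
  using assms by (auto simp: RDirProd_list_carrier)

theorem theorem4p3:
  fixes Fs :: "('a, 'm) ring_scheme list"
  assumes "\<forall>F \<in> set Fs. field F \<and> finite (carrier F)"
    and "3 \<le> length Fs"
  shows "girth (weak_zero_divisor_difference_graph (RDirProd_list Fs)) = 3"
proof -
  obtain A B C Gs where Fs: "Fs = A # B # C # Gs"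
    using assms(2) by (auto simp: numeral_3_eq_3 Suc_le_length_iff)
  interpret A: field A using assms(1) Fs by simp
  interpret B: field B using assms(1) Fs by simp
  interpret C: field C using assms(1) Fs by simp
  have rings: "ring F" if "F \<in> set Fs" for F
    using assms(1) that by (simp add: field.is_ring)
  interpret P: ring "RDirProd_list Fs"
    using rings by (intro RDirProd_list_is_ring) simp
  \<comment> \<open>\<open>Q\<close> provides the ring laws for the zero tail \<open>?o\<close> of
    the unit vectors; \<open>Gs\<close> may be empty.\<close>
  interpret Q: ring "RDirProd_list Gs"
    using rings Fs by (intro RDirProd_list_is_ring) simp
  let ?o = "\<zero>\<^bsub>RDirProd_list Gs\<^esub>"
  \<comment> \<open>The unit vectors are nonzero since \<one> \<noteq> \<zero> in each of the three
    fields.\<close>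
  show ?thesis
    by (rule P.girth_eq_3_if_orthogonal_idempotents
          [where a = "\<one>\<^bsub>A\<^esub> # \<zero>\<^bsub>B\<^esub> # \<zero>\<^bsub>C\<^esub> # ?o"
            and b = "\<zero>\<^bsub>A\<^esub> # \<one>\<^bsub>B\<^esub> # \<zero>\<^bsub>C\<^esub> # ?o"
            and c = "\<zero>\<^bsub>A\<^esub> # \<zero>\<^bsub>B\<^esub> # \<one>\<^bsub>C\<^esub> # ?o"])
      (simp_all add: Fs RDirProd_list_mult_Cons RDirProd_list_Cons_in_carrier RDirProd_list_zero')
qed

end
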